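(* If the graph $G=(V,E,s)$ is completely wired, then the homogenized toppling ideal $I(G)^h$ is a complete intersection, i.e. it is generated by $\#V-1$ homogeneous polynomials.
   Context: **Graphs.** A directed multigraph $G=(V,E)$ has a finite vertex set $V$ and edge set $E\subseteq V\times V$ with a weight function $\mathrm{wt}:V\times V\to\mathbb{N}$, $\mathrm{wt}(u,v)>0$ iff $(u,v)\in E$ (loops allowed). $\mathrm{outdeg}(v)=\sum_{u\in V}\mathrm{wt}(v,u)$. A sandpile graph $(V,E,s)$ is a directed multigraph with a vertex $s$ (the sink) that is globally accessible: from every vertex there is a directed path to $s$. The sink is absolute if $\mathrm{outdeg}(s)=0$. Write $\widetilde V=V\setminus\{s\}$. The Laplacian is $\Delta_G:\mathbb{Z}V\to\mathbb{Z}V$, $\Delta_G(v)=\mathrm{outdeg}(v)\,v-\sum_{u\in V}\mathrm{wt}(v,u)\,u$. The reduced Laplacian $\widetilde\Delta_G:\mathbb{Z}\widetilde V\to\mathbb{Z}\widetilde V$ is $\widetilde\Delta_G(v)=\mathrm{outdeg}(v)\,v-\sum_{u\in\widetilde V}\mathrm{wt}(v,u)\,u$. The toppling ideal is $I(G)=\mathrm{Span}_{\mathbb{C}}\{x^u-x^v:u,v\in\mathbb{N}\widetilde V,\ u-v\in\mathrm{im}(\widetilde\Delta_G)\}$, in the polynomial ring over $\mathbb{C}$ with one indeterminate per nonsink vertex. The homogenization of an ideal $I$ is $I^h=(f^h:f\in I)$, where $f^h=y^{\deg f}f(x_1/y,\dots,x_n/y)$ with $y$ the indeterminate corresponding to the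 sink. **Wirings.** A divisor on $G$ is an element of $\mathbb{Z}V$; divisors are linearly equivalent if their difference is in $\mathrm{im}(\Delta_G)$; $|D|$ is the set of divisors with nonnegative coefficients linearly equivalent to $D$. Let $G_i=(V_i,E_i,s_i)$, $i=1,2$, be vertex-disjoint sandpile graphs with weight functions $\mathrm{wt}_i$ and absolute sinks $s_i$. A wiring of $G_1$ into $G_2$ is a sandpile graph $G$ with vertex set $V_1\sqcup V_2$, absolute sink $s_2$, and weight function $\mathrm{wt}$ such that: $\mathrm{wt}=\mathrm{wt}_1$ on $\widetilde V_1\times V_1$; $\mathrm{wt}=\mathrm{wt}_2$ on $V_2\times V_2$; $\mathrm{wt}(u,v)=0$ for $(u,v)\in(\widetilde V_1\times V_2)\cup(V_2\times V_1)$; $\mathrm{wt}(s_1,v)>0$ for some $v\in V_2$; and the wiring divisor $D=\sum_{v\in V_1}\Delta_G(s_1)_v\,v$, regarded as a divisor on $G_1$, satisfies $|D|\neq\emptyset$. A graph is completely wired if it is a single vertex with no edges, or (recursively) a wiring of one completely wired graph into another. *)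

theory Defs
  imports Complex_Main "HOL-Library.Poly_Mapping" "HOL-Algebra.Ideal"
    "HOL-Algebra.Free_Abelian_Groups"
begin

text \<open>The weight function is only relevant on \<open>verts G \<times> verts G\<close>; the edge set is determined by it.\<close>

record 'v wgraph =
  verts :: "'v set"
  wt :: "'v \<Rightarrow> 'v \<Rightarrow> nat"
  sink :: 'v

definition edges :: "'v wgraph \<Rightarrow> ('v \<times> 'v) set" where
  "edges G = {(u, v) \<in> verts G \<times> verts G. wt G u v > 0}"

definition outdeg :: "'v wgraph \<Rightarrow> 'v \<Rightarrow> nat" where
  "outdeg G v = (\<Sum>u\<in>verts G. wt G v u)"

definition sandpile_graph :: "'v wgraph \<Rightarrow> bool" where
  "sandpile_graph G \<longleftrightarrow>
     finite (verts G) \<and> sink G \<in> verts G \<and> (\<forall>v\<in>verts G. (v, sink G) \<in> (edges G)\<^sup>*)"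

definition absolute_sink :: "'v wgraph \<Rightarrow> bool" where
  "absolute_sink G \<longleftrightarrow> outdeg G (sink G) = 0"

definition nonsinks :: "'v wgraph \<Rightarrow> 'v set" where
  "nonsinks G = verts G - {sink G}"

text \<open>The maps below are the linear extensions of their values on vertices; they are only meant to
  be applied to formal sums supported on the vertices and on the nonsink vertices, respectively.\<close>

definition laplacian :: "'v wgraph \<Rightarrow> ('v \<Rightarrow>\<^sub>0 int) \<Rightarrow> ('v \<Rightarrow>\<^sub>0 int)" where
  "laplacian G = frag_extend (\<lambda>v. frag_cmul (int (outdeg G v)) (frag_of v)
     - (\<Sum>u\<in>verts G. frag_cmul (int (wt G v u)) (frag_of u)))"

definition reduced_laplacian :: "'v wgraph \<Rightarrow> ('v \<Rightarrow>\<^sub>0 int) \<Rightarrow> ('v \<Rightarrow>\<^sub>0 int)" where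
  "reduced_laplacian G = frag_extend (\<lambda>v. frag_cmul (int (outdeg G v)) (frag_of v)
     - (\<Sum>u\<in>nonsinks G. frag_cmul (int (wt G v u)) (frag_of u)))"

definition linearly_equivalent :: "'v wgraph \<Rightarrow> ('v \<Rightarrow>\<^sub>0 int) \<Rightarrow> ('v \<Rightarrow>\<^sub>0 int) \<Rightarrow> bool" where
  "linearly_equivalent G D D' \<longleftrightarrow> D - D' \<in> laplacian G ` carrier (free_Abelian_group (verts G))"

definition complete_linear_system :: "'v wgraph \<Rightarrow> ('v \<Rightarrow>\<^sub>0 int) \<Rightarrow> ('v \<Rightarrow>\<^sub>0 int) set" where
  "complete_linear_system G D =
     {D' \<in> carrier (free_Abelian_group (verts G)). (\<forall>v. 0 \<le> Poly_Mapping.lookup D' v) \<and> linearly_equivalent G D D'}"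

definition wiring_divisor :: "'v wgraph \<Rightarrow> 'v wgraph \<Rightarrow> ('v \<Rightarrow>\<^sub>0 int)" where
  "wiring_divisor G1 G =
     (\<Sum>v\<in>verts G1. frag_cmul (Poly_Mapping.lookup (laplacian G (frag_of (sink G1))) v) (frag_of v))"

text \<open>\<open>wiring G1 G2 G\<close>: \<open>G\<close> is a wiring of \<open>G1\<close> into \<open>G2\<close>. The weights \<open>wt G (sink G1) v\<close> are
  unconstrained except by the last two conditions (in particular, loops at \<open>sink G1\<close> are allowed).\<close>

definition wiring :: "'v wgraph \<Rightarrow> 'v wgraph \<Rightarrow> 'v wgraph \<Rightarrow> bool" where
  "wiring G1 G2 G \<longleftrightarrow>
     sandpile_graph G1 \<and> absolute_sink G1 \<and>
     sandpile_graph G2 \<and> absolute_sink G2 \<and>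
     verts G1 \<inter> verts G2 = {} \<and>
     sandpile_graph G \<and> verts G = verts G1 \<union> verts G2 \<and>
     sink G = sink G2 \<and> absolute_sink G \<and>
     (\<forall>u\<in>nonsinks G1. \<forall>v\<in>verts G1. wt G u v = wt G1 u v) \<and>
     (\<forall>u\<in>verts G2. \<forall>v\<in>verts G2. wt G u v = wt G2 u v) \<and>
     (\<forall>(u, v) \<in> (nonsinks G1 \<times> verts G2) \<union> (verts G2 \<times> verts G1). wt G u v = 0) \<and>
     (\<exists>v\<in>verts G2. wt G (sink G1) v > 0) \<and>
     complete_linear_system G1 (wiring_divisor G1 G) \<noteq> {}"

inductive completely_wired :: "'v wgraph \<Rightarrow> bool" where
  single_vertex: "verts G = {sink G} \<Longrightarrow> edges G = {} \<Longrightarrow> completely_wired G"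
| wired: "completely_wired G1 \<Longrightarrow> completely_wired G2 \<Longrightarrow> wiring G1 G2 G \<Longrightarrow> completely_wired G"

text \<open>A monomial is its exponent vector \<open>'v \<Rightarrow>\<^sub>0 nat\<close>; the ring structure on the type of polynomials is
  the convolution product of \<^theory>\<open>HOL-Library.Poly_Mapping\<close>. Here all of \<open>'v\<close> serves as indeterminates;
  \<open>poly_ring A\<close> is the polynomial ring in the indeterminates indexed by \<open>A\<close>.\<close>

type_synonym 'v mpoly = "('v \<Rightarrow>\<^sub>0 nat) \<Rightarrow>\<^sub>0 complex"

definition poly_ring :: "'v set \<Rightarrow> 'v mpoly ring" where
  "poly_ring A = \<lparr>carrier = {p. \<forall>m\<in>Poly_Mapping.keys p. Poly_Mapping.keys m \<subseteq> A},
     monoid.mult = (*), one = 1, ring.zero = 0, add = (+)\<rparr>"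

lemma cring_poly_ring: "cring (poly_ring A)"
proof (rule cringI)
  show "abelian_group (poly_ring A)"
  proof (rule abelian_groupI)
    fix x y assume "x \<in> carrier (poly_ring A)" "y \<in> carrier (poly_ring A)"
    then show "x \<oplus>\<^bsub>poly_ring A\<^esub> y \<in> carrier (poly_ring A)"
      using Poly_Mapping.keys_add[of x y] unfolding poly_ring_def by simp blast
  next
    fix x assume "x \<in> carrier (poly_ring A)"
    then show "\<exists>y\<in>carrier (poly_ring A). y \<oplus>\<^bsub>poly_ring A\<^esub> x = \<zero>\<^bsub>poly_ring A\<^esub>"
      by (intro bexI[of _ "- x"]) (simp_all add: poly_ring_def)
  qed (simp_all add: poly_ring_def ac_simps)
  show "comm_monoid (poly_ring A)"
  proof (rule comm_monoidI)
    fix x y assume xy: "x \<in> carrier (poly_ring A)" "y \<in> carrier (poly_ring A)"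
    have "Poly_Mapping.keys m \<subseteq> A" if m: "m \<in> Poly_Mapping.keys (x * y)" for m
    proof -
      obtain a b where "m = a + b" "a \<in> Poly_Mapping.keys x" "b \<in> Poly_Mapping.keys y"
        using m Poly_Mapping.keys_mult[of x y] by blast
      then show ?thesis
        using xy Poly_Mapping.keys_add[of a b] unfolding poly_ring_def by simp blast
    qed
    then show "x \<otimes>\<^bsub>poly_ring A\<^esub> y \<in> carrier (poly_ring A)"
      by (simp add: poly_ring_def)
  qed (simp_all add: poly_ring_def ac_simps)
qed (simp add: poly_ring_def distrib_right)

global_interpretation mpoly: vector_space
  "\<lambda>(c :: complex) (p :: 'v mpoly). Poly_Mapping.single 0 c * p"
  defines mpoly_span = mpoly.span
proof (unfold_locales, goal_cases)
  case (1 a x y)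
  show ?case by (rule distrib_left)
next
  case (2 a b x)
  show ?case by (simp only: single_add distrib_right)
next
  case (3 a b x)
  show ?case by (simp add: mult_single flip: mult.assoc)
next
  case (4 x)
  show ?case by simp
qed

definition monomial_degree :: "('v \<Rightarrow>\<^sub>0 nat) \<Rightarrow> nat" where
  "monomial_degree m = (\<Sum>v\<in>Poly_Mapping.keys m. Poly_Mapping.lookup m v)"

definition total_degree :: "'v mpoly \<Rightarrow> nat" where
  "total_degree f = Max (insert 0 (monomial_degree ` Poly_Mapping.keys f))"

definition homogeneous :: "'v mpoly \<Rightarrow> bool" where
  "homogeneous f \<longleftrightarrow> (\<exists>d. \<forall>m\<in>Poly_Mapping.keys f. monomial_degree m = d)"

text \<open>\<open>y\<^bsup>deg f\<^esup> f(x\<^sub>1/y, \<dots>, x\<^sub>n/y)\<close>, expanded monomial by monomial.\<close>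

definition homogenize :: "'v \<Rightarrow> 'v mpoly \<Rightarrow> 'v mpoly" where
  "homogenize y f = (\<Sum>m\<in>Poly_Mapping.keys f.
     Poly_Mapping.single (m + Poly_Mapping.single y (total_degree f - monomial_degree m))
       (Poly_Mapping.lookup f m))"

definition toppling_ideal :: "'v wgraph \<Rightarrow> 'v mpoly set" where
  "toppling_ideal G = mpoly_span
     {Poly_Mapping.single u 1 - Poly_Mapping.single v 1 | u v.
        Poly_Mapping.keys u \<subseteq> nonsinks G \<and> Poly_Mapping.keys v \<subseteq> nonsinks G \<and>
        Poly_Mapping.map int u - Poly_Mapping.map int v
          \<in> reduced_laplacian G ` carrier (free_Abelian_group (nonsinks G))}"

definition homogenized_toppling_ideal :: "'v wgraph \<Rightarrow> 'v mpoly set" where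
  "homogenized_toppling_ideal G =
     Idl\<^bsub>poly_ring (verts G)\<^esub> (homogenize (sink G) ` toppling_ideal G)"

end

theory Submission
  imports Defs
begin

text \<open>
  The idea is to replace the homogenized toppling ideal by a lattice ideal and to read off generators
  from a decomposition of the lattice. If the sink of \<open>G\<close> is absolute, homogenizing the ideal of the
  reduced Laplacian lattice gives the ideal generated by all binomials \<open>x\<^sup>u - x\<^sup>v\<close> with \<open>u - v\<close> in
  the image \<open>L(G)\<close> of the full Laplacian, the variable of the sink now being included
  (\<open>homogenized_toppling_ideal_eq\<close>). The vectors of \<open>L(G)\<close> have coordinate sum zero, so these
  binomials are homogeneous.

  Let \<open>G\<close> be a wiring of \<open>G1\<close> into \<open>G2\<close> with wiring divisor \<open>D\<close>. The Laplacian of \<open>G\<close> at the sink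
  of \<open>G1\<close> is \<open>D - e\<close>, where \<open>e \<ge> 0\<close> records the new edges into \<open>G2\<close>. As \<open>D\<close> is linearly equivalent
  on \<open>G1\<close> to an effective divisor \<open>d\<close>, we get \<open>L(G) = L(G1) + L(G2) + \<int> (d - e)\<close>
  (\<open>wiring_lattice\<close>). Effectivity of \<open>d\<close> makes \<open>x\<^sup>d - x\<^sup>e\<close> a binomial whose two
  monomials live on the two disjoint sets of variables. Modulo it and the binomials of \<open>L(G1)\<close> and
  \<open>L(G2)\<close>, every \<open>x\<^sup>u\<close> can be rewritten to \<open>x\<^sup>v\<close> whenever \<open>u - v\<close> lies in \<open>L(G)\<close>
  (\<open>binomial_glue\<close>): the \<open>G1\<close> part of \<open>u\<close> is congruent to that of \<open>v\<close> times a power of \<open>x\<^sup>d\<close>, the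
  power of \<open>x\<^sup>d\<close> is traded for the same power of \<open>x\<^sup>e\<close>, and the latter is absorbed by the \<open>G2\<close> part.
  Each wiring thus adds exactly one generator, and induction gives
  \<open>(#V1 - 1) + (#V2 - 1) + 1 = #V - 1\<close> of them (\<open>completely_wired_generators\<close>).
\<close>

section \<open>Ideals of polynomial rings and congruence of monomials\<close>

abbreviation mon :: "('v \<Rightarrow>\<^sub>0 nat) \<Rightarrow> 'v mpoly" where
  "mon m \<equiv> Poly_Mapping.single m 1"

lemma mon_add: "mon (a + b) = mon a * mon b"
  by (simp add: mult_single)

lemma carrier_poly_ring_iff:
  "p \<in> carrier (poly_ring A) \<longleftrightarrow> (\<forall>m\<in>Poly_Mapping.keys p. Poly_Mapping.keys m \<subseteq> A)"
  by (simp add: poly_ring_def)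

lemma single_in_poly_ring: "Poly_Mapping.keys m \<subseteq> A \<Longrightarrow> Poly_Mapping.single m c \<in> carrier (poly_ring A)"
  by (simp add: carrier_poly_ring_iff)

lemma poly_ring_mono: "A \<subseteq> B \<Longrightarrow> carrier (poly_ring A) \<subseteq> carrier (poly_ring B)"
  by (simp add: poly_ring_def) blast

lemma ring_poly_ring: "ring (poly_ring A)"
  by (rule cring.axioms(1)[OF cring_poly_ring])

lemma a_inv_poly_ring:
  assumes "p \<in> carrier (poly_ring A)"
  shows "\<ominus>\<^bsub>poly_ring A\<^esub> p = - p"
proof -
  interpret cring "poly_ring A" by (rule cring_poly_ring)
  have "- p \<in> carrier (poly_ring A)" using assms by (simp add: carrier_poly_ring_iff)
  then show ?thesis using assms by (intro minus_equality) (simp_all add: poly_ring_def)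
qed

lemma ideal_poly_ringD:
  assumes "ideal J (poly_ring A)"
  shows ideal_zero: "0 \<in> J"
    and ideal_add: "a \<in> J \<Longrightarrow> b \<in> J \<Longrightarrow> a + b \<in> J"
    and ideal_uminus: "a \<in> J \<Longrightarrow> - a \<in> J"
    and ideal_mult: "r \<in> carrier (poly_ring A) \<Longrightarrow> a \<in> J \<Longrightarrow> r * a \<in> J"
    and ideal_carrier: "J \<subseteq> carrier (poly_ring A)"
proof -
  interpret ideal J "poly_ring A" by fact
  show "0 \<in> J" using additive_subgroup.zero_closed[OF is_additive_subgroup] by (simp add: poly_ring_def)
  show "a \<in> J \<Longrightarrow> b \<in> J \<Longrightarrow> a + b \<in> J" using additive_subgroup.a_closed[OF is_additive_subgroup, of a b]
    by (simp add: poly_ring_def)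
  show "a \<in> J \<Longrightarrow> - a \<in> J" 
    using additive_subgroup.a_inv_closed[OF is_additive_subgroup, of a] a_inv_poly_ring[of a A] a_subset
    by auto
  show "r \<in> carrier (poly_ring A) \<Longrightarrow> a \<in> J \<Longrightarrow> r * a \<in> J"
    using I_l_closed[of a r] by (simp add: poly_ring_def)
  show "J \<subseteq> carrier (poly_ring A)" by (rule a_subset)
qed

lemma ideal_sum:
  assumes "ideal J (poly_ring A)" "\<And>i. i \<in> I \<Longrightarrow> f i \<in> J"
  shows "sum f I \<in> J"
  using assms(2)
  by (induction I rule: infinite_finite_induct)
    (auto intro: ideal_add[OF assms(1)] ideal_zero[OF assms(1)])

text \<open>Contraction to fewer variables; it lets membership in an ideal generated over a subgraph be
  transported to an ideal over the whole graph.\<close>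

lemma ideal_Int_poly_ring:
  assumes J: "ideal J (poly_ring B)" and "A \<subseteq> B"
  shows "ideal (J \<inter> carrier (poly_ring A)) (poly_ring A)"
proof (rule idealI)
  interpret R: cring "poly_ring A" by (rule cring_poly_ring)
  show "ring (poly_ring A)" by (rule ring_poly_ring)
  have mult: "x * a \<in> J \<inter> carrier (poly_ring A)"
    if "a \<in> J \<inter> carrier (poly_ring A)" "x \<in> carrier (poly_ring A)" for a x
  proof -
    have "x \<in> carrier (poly_ring B)" using that poly_ring_mono[OF \<open>A \<subseteq> B\<close>] by blast
    then have "x * a \<in> J" using that ideal_mult[OF J] by blast
    moreover have "x * a \<in> carrier (poly_ring A)"
      using that R.m_closed[of x a] by (simp add: poly_ring_def)
    ultimately show ?thesis by simp
  qed
  show "x \<otimes>\<^bsub>poly_ring A\<^esub> a \<in> J \<inter> carrier (poly_ring A)"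
    if "a \<in> J \<inter> carrier (poly_ring A)" "x \<in> carrier (poly_ring A)" for a x
  proof -
    have "x \<otimes>\<^bsub>poly_ring A\<^esub> a = x * a" by (simp add: poly_ring_def)
    with mult[OF that] show ?thesis by metis
  qed
  show "a \<otimes>\<^bsub>poly_ring A\<^esub> x \<in> J \<inter> carrier (poly_ring A)"
    if "a \<in> J \<inter> carrier (poly_ring A)" "x \<in> carrier (poly_ring A)" for a x
  proof -
    have "a \<otimes>\<^bsub>poly_ring A\<^esub> x = x * a" by (simp add: poly_ring_def mult.commute)
    with mult[OF that] show ?thesis by metis
  qed
  show "subgroup (J \<inter> carrier (poly_ring A)) (add_monoid (poly_ring A))"
  proof (rule R.add.subgroupI)
    show "J \<inter> carrier (poly_ring A) \<subseteq> carrier (poly_ring A)" by simp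
    have "0 \<in> carrier (poly_ring A)" by (simp add: carrier_poly_ring_iff)
    then show "J \<inter> carrier (poly_ring A) \<noteq> {}" using ideal_zero[OF J] by blast
    show "\<ominus>\<^bsub>poly_ring A\<^esub> a \<in> J \<inter> carrier (poly_ring A)" if "a \<in> J \<inter> carrier (poly_ring A)" for a
    proof -
      have "\<ominus>\<^bsub>poly_ring A\<^esub> a = - a"
        using that a_inv_poly_ring by blast
      moreover have "- a \<in> J" using that ideal_uminus[OF J] by blast
      moreover have "- a \<in> carrier (poly_ring A)" using that by (simp add: carrier_poly_ring_iff)
      ultimately show ?thesis by simp
    qed
    show "a \<oplus>\<^bsub>poly_ring A\<^esub> b \<in> J \<inter> carrier (poly_ring A)"
      if "a \<in> J \<inter> carrier (poly_ring A)" "b \<in> J \<inter> carrier (poly_ring A)" for a b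
    proof -
      have "a \<oplus>\<^bsub>poly_ring A\<^esub> b = a + b" by (simp add: poly_ring_def)
      moreover have "a + b \<in> J" using that ideal_add[OF J] by blast
      moreover have "a \<oplus>\<^bsub>poly_ring A\<^esub> b \<in> carrier (poly_ring A)"
        using that by (simp add: R.a_closed)
      ultimately show ?thesis by simp
    qed
  qed
qed

lemma genideal_mono_carrier:
  assumes J: "ideal J (poly_ring B)" and "A \<subseteq> B" "F \<subseteq> J" "F \<subseteq> carrier (poly_ring A)"
  shows "Idl\<^bsub>poly_ring A\<^esub> F \<subseteq> J"
proof -
  have "Idl\<^bsub>poly_ring A\<^esub> F \<subseteq> J \<inter> carrier (poly_ring A)"
    using assms by (intro ring.genideal_minimal[OF ring_poly_ring] ideal_Int_poly_ring) auto
  then show ?thesis by simp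
qed

lemma cong_sym:
  "ideal J (poly_ring A) \<Longrightarrow> mon u - mon v \<in> J \<Longrightarrow> mon v - mon u \<in> J"
  using ideal_uminus[of J A "mon u - mon v"] by simp

lemma cong_trans:
  "ideal J (poly_ring A) \<Longrightarrow> mon u - mon v \<in> J \<Longrightarrow> mon v - mon w \<in> J \<Longrightarrow> mon u - mon w \<in> J"
  using ideal_add[of J A "mon u - mon v" "mon v - mon w"] by simp

lemma cong_add:
  assumes "ideal J (poly_ring A)" "Poly_Mapping.keys w \<subseteq> A" "mon u - mon v \<in> J"
  shows "mon (w + u) - mon (w + v) \<in> J"
  using ideal_mult[OF assms(1) single_in_poly_ring[OF assms(2)] assms(3), of 1]
  by (simp add: mon_add right_diff_distrib)

section \<open>Exponent vectors and lattice binomials\<close>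

definition restrict_to :: "'v set \<Rightarrow> ('v \<Rightarrow>\<^sub>0 'b::zero) \<Rightarrow> 'v \<Rightarrow>\<^sub>0 'b" where
  "restrict_to A p = Poly_Mapping.mapp (\<lambda>k x. if k \<in> A then x else 0) p"

lemma lookup_restrict_to [simp]:
  "Poly_Mapping.lookup (restrict_to A p) k = (if k \<in> A then Poly_Mapping.lookup p k else 0)"
  by (simp add: restrict_to_def lookup_mapp when_def in_keys_iff)

lemma keys_restrict_to: "Poly_Mapping.keys (restrict_to A p) = Poly_Mapping.keys p \<inter> A"
  by (auto simp: in_keys_iff split: if_splits)

lemma restrict_to_0: "restrict_to A 0 = 0"
  by (rule poly_mapping_eqI) simp

lemma restrict_to_diff: "restrict_to A (p - q) = restrict_to A p - restrict_to A (q :: 'v \<Rightarrow>\<^sub>0 int)"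
  by (rule poly_mapping_eqI) (simp add: lookup_minus)

lemma lookup_map_int [simp]:
  "Poly_Mapping.lookup (Poly_Mapping.map int u) k = int (Poly_Mapping.lookup u k)"
  by (simp add: Poly_Mapping.map.rep_eq when_def)

lemma keys_map_int [simp]: "Poly_Mapping.keys (Poly_Mapping.map int u) = Poly_Mapping.keys u"
  by (auto simp: in_keys_iff)

lemma lookup_outside: "Poly_Mapping.keys p \<subseteq> A \<Longrightarrow> x \<notin> A \<Longrightarrow> Poly_Mapping.lookup p x = 0"
  by (auto simp: in_keys_iff)

text \<open>The binomials that generate the lattice ideal of \<open>L\<close> in the variables \<open>A\<close>.\<close>

definition lattice_binomials :: "'v set \<Rightarrow> ('v \<Rightarrow>\<^sub>0 int) set \<Rightarrow> 'v mpoly set" where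
  "lattice_binomials A L = {mon u - mon v | u v. Poly_Mapping.keys u \<subseteq> A \<and> Poly_Mapping.keys v \<subseteq> A \<and>
     Poly_Mapping.map int u - Poly_Mapping.map int v \<in> L}"

lemma lattice_binomialsI:
  "Poly_Mapping.keys u \<subseteq> A \<Longrightarrow> Poly_Mapping.keys v \<subseteq> A \<Longrightarrow>
    Poly_Mapping.map int u - Poly_Mapping.map int v \<in> L \<Longrightarrow> mon u - mon v \<in> lattice_binomials A L"
  by (auto simp: lattice_binomials_def)

lemma lattice_binomials_carrier: "lattice_binomials A L \<subseteq> carrier (poly_ring A)"
  using keys_diff by (fastforce simp: lattice_binomials_def carrier_poly_ring_iff)

text \<open>Split \<open>u\<close> and \<open>v\<close> along the disjoint variable sets. On \<open>A\<close> the equation says that \<open>u\<close> and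
  \<open>v + k d\<close> differ by an element of \<open>L1\<close>, on \<open>B\<close> that \<open>u + k e\<close> and \<open>v\<close> differ by an element of
  \<open>L2\<close>. All four exponents are nonnegative because \<open>k\<close>, \<open>d\<close> and \<open>e\<close> are, so these are congruences
  between genuine monomials, and exchanging \<open>k d\<close> for \<open>k e\<close> links them.\<close>

lemma binomial_glue:
  assumes J: "ideal J (poly_ring (A \<union> B))" and disj: "A \<inter> B = {}"
    and L1: "lattice_binomials A L1 \<subseteq> J" and L2: "lattice_binomials B L2 \<subseteq> J"
    and d: "Poly_Mapping.keys d \<subseteq> A" and e: "Poly_Mapping.keys e \<subseteq> B" and de: "mon d - mon e \<in> J"
    and u: "Poly_Mapping.keys u \<subseteq> A \<union> B" and v: "Poly_Mapping.keys v \<subseteq> A \<union> B"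
    and l1: "l1 \<in> L1" "Poly_Mapping.keys l1 \<subseteq> A" and l2: "l2 \<in> L2" "Poly_Mapping.keys l2 \<subseteq> B"
    and eq: "Poly_Mapping.map int u - Poly_Mapping.map int v =
      l1 + l2 + frag_cmul (int k) (Poly_Mapping.map int d - Poly_Mapping.map int e)"
  shows "mon u - mon v \<in> J"
proof -
  define kd where "kd = (\<Sum>i<k. d)"
  define ke where "ke = (\<Sum>i<k. e)"
  have kd: "Poly_Mapping.lookup kd x = k * Poly_Mapping.lookup d x"
    and ke: "Poly_Mapping.lookup ke x = k * Poly_Mapping.lookup e x" for x
    by (simp_all add: kd_def ke_def lookup_sum)
  have keys_k: "Poly_Mapping.keys kd \<subseteq> A" "Poly_Mapping.keys ke \<subseteq> B"
    using d e by (auto simp: in_keys_iff kd ke)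
  have kde: "mon kd - mon ke \<in> J"
    unfolding kd_def ke_def
  proof (induction k)
    case 0
    then show ?case using ideal_zero[OF J] by simp
  next
    case (Suc k)
    have "Poly_Mapping.keys (\<Sum>i<k. e) \<subseteq> Poly_Mapping.keys e"
      by (rule subsetI) (simp add: in_keys_iff lookup_sum)
    then have "Poly_Mapping.keys (\<Sum>i<k. e) \<subseteq> A \<union> B" "Poly_Mapping.keys d \<subseteq> A \<union> B"
      using d e by auto
    from cong_add[OF J this(2) Suc] cong_add[OF J this(1) de]
    show ?case by (auto simp: add.commute intro: cong_trans[OF J])
  qed
  define u1 u2 v1 v2 where uv_def: "u1 = restrict_to A u" "u2 = restrict_to B u"
    "v1 = restrict_to A v" "v2 = restrict_to B v"
  have keys: "Poly_Mapping.keys u1 \<subseteq> A" "Poly_Mapping.keys u2 \<subseteq> B"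
    "Poly_Mapping.keys v1 \<subseteq> A" "Poly_Mapping.keys v2 \<subseteq> B"
    by (auto simp: uv_def keys_restrict_to)
  have split: "u = u1 + u2" "v = v1 + v2"
    using disj lookup_outside[OF u] lookup_outside[OF v]
    by (auto intro!: poly_mapping_eqI simp: uv_def lookup_add)
  have eq': "int (Poly_Mapping.lookup u x) - int (Poly_Mapping.lookup v x) =
      Poly_Mapping.lookup l1 x + Poly_Mapping.lookup l2 x
      + int k * (int (Poly_Mapping.lookup d x) - int (Poly_Mapping.lookup e x))" for x
    using arg_cong[OF eq, of "\<lambda>p. Poly_Mapping.lookup p x"]
    by (simp add: lookup_add lookup_minus)
  have "Poly_Mapping.map int u1 - Poly_Mapping.map int (v1 + kd) = l1"
  proof (rule poly_mapping_eqI)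
    fix x
    show "Poly_Mapping.lookup (Poly_Mapping.map int u1 - Poly_Mapping.map int (v1 + kd)) x
        = Poly_Mapping.lookup l1 x"
    proof (cases "x \<in> A")
      case True
      then have "x \<notin> B" using disj by auto
      with True eq'[of x] lookup_outside[OF e] lookup_outside[OF l2(2)] show ?thesis
        by (simp add: uv_def lookup_add lookup_minus kd)
    next
      case False
      with lookup_outside[OF d] lookup_outside[OF l1(2)] show ?thesis
        by (simp add: uv_def lookup_add lookup_minus kd)
    qed
  qed
  with l1 keys keys_k have "mon u1 - mon (v1 + kd) \<in> J"
    using Poly_Mapping.keys_add[of v1 kd] by (intro subsetD[OF L1] lattice_binomialsI) auto
  from cong_add[OF J _ this, of u2] have 1: "mon u - mon (u2 + (v1 + kd)) \<in> J"
    using keys by (auto simp: split add.commute)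
  have "Poly_Mapping.map int (u2 + ke) - Poly_Mapping.map int v2 = l2"
  proof (rule poly_mapping_eqI)
    fix x
    show "Poly_Mapping.lookup (Poly_Mapping.map int (u2 + ke) - Poly_Mapping.map int v2) x
        = Poly_Mapping.lookup l2 x"
    proof (cases "x \<in> B")
      case True
      then have "x \<notin> A" using disj by auto
      with True eq'[of x] lookup_outside[OF d] lookup_outside[OF l1(2)] show ?thesis
        by (simp add: uv_def lookup_add lookup_minus ke)
    next
      case False
      with lookup_outside[OF e] lookup_outside[OF l2(2)] show ?thesis
        by (simp add: uv_def lookup_add lookup_minus ke)
    qed
  qed
  with l2 keys keys_k have "mon (u2 + ke) - mon v2 \<in> J"
    using Poly_Mapping.keys_add[of u2 ke] by (intro subsetD[OF L2] lattice_binomialsI) auto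
  from cong_add[OF J _ this, of v1] have 3: "mon (v1 + (u2 + ke)) - mon v \<in> J"
    using keys by (auto simp: split)
  have "mon ((u2 + v1) + kd) - mon ((u2 + v1) + ke) \<in> J"
    using keys Poly_Mapping.keys_add[of u2 v1] by (intro cong_add[OF J _ kde]) auto
  then have 2: "mon (u2 + (v1 + kd)) - mon (v1 + (u2 + ke)) \<in> J"
    by (simp add: ac_simps)
  from cong_trans[OF J 1 cong_trans[OF J 2 3]] show ?thesis .
qed

section \<open>The lattice of the full Laplacian\<close>

definition laplacian_lattice :: "'v wgraph \<Rightarrow> ('v \<Rightarrow>\<^sub>0 int) set" where
  "laplacian_lattice G = laplacian G ` carrier (free_Abelian_group (verts G))"

lemma laplacian_latticeI:
  "Poly_Mapping.keys D \<subseteq> verts G \<Longrightarrow> laplacian G D \<in> laplacian_lattice G"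
  by (simp add: laplacian_lattice_def)

lemma laplacian_diff: "laplacian G (a - b) = laplacian G a - laplacian G b"
  by (simp add: laplacian_def frag_extend_diff)

lemma laplacian_add: "laplacian G (a + b) = laplacian G a + laplacian G b"
  by (simp add: laplacian_def frag_extend_add)

lemma laplacian_cmul: "laplacian G (frag_cmul c a) = frag_cmul c (laplacian G a)"
  by (simp add: laplacian_def frag_extend_cmul)

lemma laplacian_0: "laplacian G 0 = 0"
  by (simp add: laplacian_def)

text \<open>Evaluates the sums over vertices from which both the Laplacian and the wiring divisor are built.\<close>

lemma lookup_vertex_sum:
  assumes "finite A"
  shows "Poly_Mapping.lookup (\<Sum>u\<in>A. frag_cmul (f u) (frag_of u)) x = (if x \<in> A then f x else 0)"
proof -
  have "f u * (if x = u then 1 else 0) = (if x = u then f u else 0)" for u by simp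
  then show ?thesis using assms by (simp add: lookup_sum)
qed

lemma lookup_laplacian_frag_of:
  assumes "finite (verts G)"
  shows "Poly_Mapping.lookup (laplacian G (frag_of v)) x =
    (if x = v then int (outdeg G v) else 0) - (if x \<in> verts G then int (wt G v x) else 0)"
  using assms by (simp add: laplacian_def lookup_minus lookup_vertex_sum)

lemma keys_laplacian:
  assumes "finite (verts G)" "Poly_Mapping.keys D \<subseteq> verts G"
  shows "Poly_Mapping.keys (laplacian G D) \<subseteq> verts G"
  using assms(2)
proof (induction rule: frag_induction)
  case (one x)
  have "Poly_Mapping.lookup (laplacian G (frag_of x)) y = 0" if "y \<notin> verts G" for y
  proof -
    have "y \<noteq> x" using that one by blast
    then show ?thesis using that by (simp add: lookup_laplacian_frag_of[OF assms(1)])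
  qed
  then show ?case by (meson in_keys_iff subsetI)
next
  case (diff a b)
  have "Poly_Mapping.keys (laplacian G (a - b)) \<subseteq>
      Poly_Mapping.keys (laplacian G a) \<union> Poly_Mapping.keys (laplacian G b)"
    unfolding laplacian_diff by (rule keys_diff)
  with diff show ?case by blast
qed (simp add: laplacian_0)

lemma sum_laplacian:
  assumes "finite (verts G)" "Poly_Mapping.keys D \<subseteq> verts G"
  shows "(\<Sum>v\<in>verts G. Poly_Mapping.lookup (laplacian G D) v) = 0"
  using assms(2)
proof (induction rule: frag_induction)
  case (one x)
  then show ?case using assms(1)
    by (simp add: lookup_laplacian_frag_of sum_subtractf outdeg_def)
qed (simp_all add: laplacian_0 laplacian_diff lookup_minus sum_subtractf)

lemma laplacian_sink:
  assumes "finite (verts G)" "sink G \<in> verts G" "absolute_sink G"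
  shows "laplacian G (frag_of (sink G)) = 0"
  using assms by (intro poly_mapping_eqI) (auto simp: lookup_laplacian_frag_of absolute_sink_def outdeg_def)

text \<open>The Laplacian vanishes at an absolute sink, hence a divisor may be changed there at will.\<close>

lemma laplacian_restrict_nonsinks:
  assumes "finite (verts G)" "sink G \<in> verts G" "absolute_sink G" "Poly_Mapping.keys D \<subseteq> verts G"
  shows "laplacian G (restrict_to (nonsinks G) D) = laplacian G D"
proof -
  have "D = restrict_to (nonsinks G) D + frag_cmul (Poly_Mapping.lookup D (sink G)) (frag_of (sink G))"
    using lookup_outside[OF assms(4)] assms(2)
    by (intro poly_mapping_eqI) (auto simp: lookup_add nonsinks_def)
  then show ?thesis
    by (metis laplacian_add laplacian_cmul laplacian_sink[OF assms(1-3)] frag_cmul_zero2 add_0_right)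
qed

lemma reduced_laplacian_eq:
  assumes "finite (verts G)" "sink G \<in> verts G" "Poly_Mapping.keys D \<subseteq> nonsinks G"
  shows "reduced_laplacian G D = restrict_to (nonsinks G) (laplacian G D)"
  using assms(3)
proof (induction rule: frag_induction)
  case (one x)
  have "finite (nonsinks G)" using assms(1) by (simp add: nonsinks_def)
  with one assms(1,2) show ?case
    by (intro poly_mapping_eqI)
      (auto simp: lookup_laplacian_frag_of reduced_laplacian_def lookup_minus lookup_vertex_sum nonsinks_def)
qed (simp_all add: laplacian_0 restrict_to_0 laplacian_diff restrict_to_diff
    reduced_laplacian_def frag_extend_diff)

text \<open>Deleting the sink coordinate loses nothing: the coordinate sum of a Laplacian image is zero, so
  the sink coordinate is determined by the others. In this sense the lattice of the full Laplacian is the homogenization of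
  the lattice of the reduced one.\<close>

lemma mem_laplacian_lattice_iff:
  assumes fin: "finite (verts G)" and s: "sink G \<in> verts G" and abs: "absolute_sink G"
  shows "w \<in> laplacian_lattice G \<longleftrightarrow>
    Poly_Mapping.keys w \<subseteq> verts G \<and> (\<Sum>v\<in>verts G. Poly_Mapping.lookup w v) = 0 \<and>
    restrict_to (nonsinks G) w \<in> reduced_laplacian G ` carrier (free_Abelian_group (nonsinks G))"
    (is "?L \<longleftrightarrow> ?R")
proof
  assume ?L
  then obtain D where D: "Poly_Mapping.keys D \<subseteq> verts G" "w = laplacian G D"
    by (auto simp: laplacian_lattice_def)
  define D' where "D' = restrict_to (nonsinks G) D"
  have D'_keys: "Poly_Mapping.keys D' \<subseteq> nonsinks G" by (simp add: D'_def keys_restrict_to)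
  have "laplacian G D' = laplacian G D"
    unfolding D'_def by (rule laplacian_restrict_nonsinks[OF fin s abs D(1)])
  then have "restrict_to (nonsinks G) w = reduced_laplacian G D'"
    using reduced_laplacian_eq[OF fin s D'_keys] D by simp
  then show ?R using D keys_laplacian[OF fin D(1)] sum_laplacian[OF fin D(1)] D'_keys by auto
next
  assume R: ?R
  then obtain D where D: "Poly_Mapping.keys D \<subseteq> nonsinks G"
    "restrict_to (nonsinks G) w = restrict_to (nonsinks G) (laplacian G D)"
    using reduced_laplacian_eq[OF fin s] by auto
  have DV: "Poly_Mapping.keys D \<subseteq> verts G" using D by (auto simp: nonsinks_def)
  have eq: "Poly_Mapping.lookup w x = Poly_Mapping.lookup (laplacian G D) x" if "x \<in> nonsinks G" for x
    using arg_cong[OF D(2), of "\<lambda>p. Poly_Mapping.lookup p x"] that by simp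
  have "(\<Sum>v\<in>nonsinks G. Poly_Mapping.lookup w v) = (\<Sum>v\<in>nonsinks G. Poly_Mapping.lookup (laplacian G D) v)"
    using eq by simp
  moreover have "(\<Sum>v\<in>verts G. f v) = f (sink G) + (\<Sum>v\<in>nonsinks G. f v)" for f :: "_ \<Rightarrow> int"
    unfolding nonsinks_def by (rule sum.remove[OF fin s])
  ultimately have "Poly_Mapping.lookup w (sink G) = Poly_Mapping.lookup (laplacian G D) (sink G)"
    using R sum_laplacian[OF fin DV] by simp
  then have "w = laplacian G D"
    using R eq lookup_outside[of w "verts G"] lookup_outside[OF keys_laplacian[OF fin DV]]
    by (intro poly_mapping_eqI) (metis DiffI nonsinks_def singletonD)
  then show ?L using laplacian_latticeI[OF DV] by simp
qed

section \<open>Homogenizing the toppling ideal\<close>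

lemma monomial_degree_eq:
  assumes "finite A" "Poly_Mapping.keys m \<subseteq> A"
  shows "monomial_degree m = (\<Sum>v\<in>A. Poly_Mapping.lookup m v)"
  unfolding monomial_degree_def using assms
  by (intro sum.mono_neutral_left) (auto simp: in_keys_iff)

lemma laplacian_lattice_monomial_degree_eq:
  assumes fin: "finite (verts G)"
    and u: "Poly_Mapping.keys u \<subseteq> verts G" and v: "Poly_Mapping.keys v \<subseteq> verts G"
    and uv: "Poly_Mapping.map int u - Poly_Mapping.map int v \<in> laplacian_lattice G"
  shows "monomial_degree u = monomial_degree v"
proof -
  have "(\<Sum>x\<in>verts G. Poly_Mapping.lookup (Poly_Mapping.map int u - Poly_Mapping.map int v) x) = 0"
    using uv sum_laplacian[OF fin] by (auto simp: laplacian_lattice_def)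
  then show ?thesis
    unfolding monomial_degree_eq[OF fin u] monomial_degree_eq[OF fin v]
    by (simp add: lookup_minus sum_subtractf flip: of_nat_sum)
qed

definition homogenize_monomial :: "'v \<Rightarrow> nat \<Rightarrow> ('v \<Rightarrow>\<^sub>0 nat) \<Rightarrow> 'v \<Rightarrow>\<^sub>0 nat" where
  "homogenize_monomial y n m = m + Poly_Mapping.single y (n - monomial_degree m)"

lemma monomial_degree_homogenize_monomial:
  assumes "finite A" "y \<in> A" "Poly_Mapping.keys m \<subseteq> A" "monomial_degree m \<le> n"
  shows "(\<Sum>v\<in>A. Poly_Mapping.lookup (homogenize_monomial y n m) v) = n"
  using assms
  by (simp add: homogenize_monomial_def lookup_add sum.distrib monomial_degree_eq lookup_single when_def)

lemma keys_homogenize_monomial: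
  "Poly_Mapping.keys (homogenize_monomial y n m) \<subseteq> insert y (Poly_Mapping.keys m)"
  using Poly_Mapping.keys_add[of m "Poly_Mapping.single y (n - monomial_degree m)"]
  by (auto simp: homogenize_monomial_def split: if_splits)

text \<open>The linear extension of a map of monomials. For a map that is constant on the classes
  of a lattice, it annihilates the span of the lattice binomials.\<close>

definition push_monomials :: "(('v \<Rightarrow>\<^sub>0 nat) \<Rightarrow> 'v \<Rightarrow>\<^sub>0 nat) \<Rightarrow> 'v mpoly \<Rightarrow> 'v mpoly" where
  "push_monomials \<rho> f = (\<Sum>m\<in>Poly_Mapping.keys f. Poly_Mapping.single (\<rho> m) (Poly_Mapping.lookup f m))"

lemma push_monomials_superset:
  assumes "finite A" "Poly_Mapping.keys f \<subseteq> A"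
  shows "push_monomials \<rho> f = (\<Sum>m\<in>A. Poly_Mapping.single (\<rho> m) (Poly_Mapping.lookup f m))"
  unfolding push_monomials_def using assms
  by (intro sum.mono_neutral_left) (auto simp: in_keys_iff)

lemma push_monomials_add: "push_monomials \<rho> (f + g) = push_monomials \<rho> f + push_monomials \<rho> g"
proof -
  let ?A = "Poly_Mapping.keys f \<union> Poly_Mapping.keys g"
  have "push_monomials \<rho> f = (\<Sum>m\<in>?A. Poly_Mapping.single (\<rho> m) (Poly_Mapping.lookup f m))"
    "push_monomials \<rho> g = (\<Sum>m\<in>?A. Poly_Mapping.single (\<rho> m) (Poly_Mapping.lookup g m))"
    "push_monomials \<rho> (f + g) = (\<Sum>m\<in>?A. Poly_Mapping.single (\<rho> m) (Poly_Mapping.lookup (f + g) m))"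
    using Poly_Mapping.keys_add[of f g] by (intro push_monomials_superset; simp)+
  then show ?thesis by (simp add: lookup_add single_add sum.distrib)
qed

lemma push_monomials_single: "push_monomials \<rho> (Poly_Mapping.single m c) = Poly_Mapping.single (\<rho> m) c"
  by (simp add: push_monomials_def)

lemma toppling_ideal_eq_span:
  "toppling_ideal G = mpoly_span (lattice_binomials (nonsinks G)
     (reduced_laplacian G ` carrier (free_Abelian_group (nonsinks G))))"
  by (simp add: toppling_ideal_def lattice_binomials_def)

lemma push_monomials_toppling_ideal:
  assumes f: "f \<in> toppling_ideal G"
    and \<rho>: "\<And>u v. Poly_Mapping.keys u \<subseteq> nonsinks G \<Longrightarrow> Poly_Mapping.keys v \<subseteq> nonsinks G \<Longrightarrow>
        Poly_Mapping.map int u - Poly_Mapping.map int v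
          \<in> reduced_laplacian G ` carrier (free_Abelian_group (nonsinks G)) \<Longrightarrow> \<rho> u = \<rho> v"
  shows "push_monomials \<rho> f = 0"
  using f unfolding toppling_ideal_eq_span
proof (induction rule: mpoly.span_induct_alt)
  case base
  show ?case by (simp add: push_monomials_def)
next
  case (step c x y)
  then obtain u v where uv: "x = mon u - mon v" "\<rho> u = \<rho> v"
    using \<rho> by (auto simp: lattice_binomials_def)
  have "Poly_Mapping.single 0 c * x = Poly_Mapping.single u c + Poly_Mapping.single v (- c)"
    by (simp add: uv right_diff_distrib mult_single single_uminus)
  then show ?case using step uv
    by (simp add: push_monomials_add push_monomials_single flip: single_add)
qed

lemma toppling_ideal_carrier: "toppling_ideal G \<subseteq> carrier (poly_ring (nonsinks G))"
proof
  fix f assume "f \<in> toppling_ideal G"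
  then show "f \<in> carrier (poly_ring (nonsinks G))"
    unfolding toppling_ideal_eq_span
  proof (induction rule: mpoly.span_induct_alt)
    case base
    show ?case by (simp add: carrier_poly_ring_iff)
  next
    case (step c x y)
    interpret cring "poly_ring (nonsinks G)" by (rule cring_poly_ring)
    have "Poly_Mapping.single 0 c \<in> carrier (poly_ring (nonsinks G))"
      by (rule single_in_poly_ring) simp
    moreover have "x \<in> carrier (poly_ring (nonsinks G))"
      using step(1) lattice_binomials_carrier by blast
    ultimately have "Poly_Mapping.single 0 c \<otimes>\<^bsub>poly_ring (nonsinks G)\<^esub> x \<oplus>\<^bsub>poly_ring (nonsinks G)\<^esub> y
        \<in> carrier (poly_ring (nonsinks G))"
      using step(2) by (intro a_closed m_closed)
    then show ?case by (simp add: poly_ring_def)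
  qed
qed

text \<open>The point is that homogenizing is not linear when degrees drop, so it cannot be applied
  to an arbitrary expression of \<open>f\<close> as a combination of binomials. One expression does behave well:
  \<open>f = \<Sum> f\<^sub>m (x\<^sup>m - x\<^bsup>r(m)\<^esup>)\<close> over the monomials \<open>m\<close> of \<open>f\<close>, where \<open>r(m)\<close> has
  least degree in the class of \<open>m\<close> modulo the lattice. All monomials in it have degree at most
  \<open>deg f\<close>, so it can be homogenized term by term to degree \<open>deg f\<close>.

  Conversely, a binomial of the full lattice is, up to a power of the sink variable, the homogenization
  of the binomial obtained by setting that variable to \<open>1\<close>.\<close>

lemma homogenized_toppling_ideal_eq:
  assumes fin: "finite (verts G)" and s: "sink G \<in> verts G" and abs: "absolute_sink G"
  shows "homogenized_toppling_ideal G =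
    Idl\<^bsub>poly_ring (verts G)\<^esub> (lattice_binomials (verts G) (laplacian_lattice G))"
proof
  let ?L = "reduced_laplacian G ` carrier (free_Abelian_group (nonsinks G))"
  let ?V = "verts G" and ?N = "nonsinks G" and ?y = "sink G"
  let ?J = "Idl\<^bsub>poly_ring ?V\<^esub> (lattice_binomials ?V (laplacian_lattice G))"
  interpret R: cring "poly_ring ?V" by (rule cring_poly_ring)
  have J: "ideal ?J (poly_ring ?V)"
    by (intro R.genideal_ideal lattice_binomials_carrier)
  have J_binomial: "lattice_binomials ?V (laplacian_lattice G) \<subseteq> ?J"
    by (intro R.genideal_self lattice_binomials_carrier)
  have hom_in_J: "mon (homogenize_monomial ?y n u) - mon (homogenize_monomial ?y n v) \<in> ?J"
    if u: "Poly_Mapping.keys u \<subseteq> ?N" "monomial_degree u \<le> n"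
      and v: "Poly_Mapping.keys v \<subseteq> ?N" "monomial_degree v \<le> n"
      and uv: "Poly_Mapping.map int u - Poly_Mapping.map int v \<in> ?L" for u v n
  proof (intro subsetD[OF J_binomial] lattice_binomialsI)
    let ?h = "homogenize_monomial ?y n"
    have V: "Poly_Mapping.keys u \<subseteq> ?V" "Poly_Mapping.keys v \<subseteq> ?V"
      using u v by (auto simp: nonsinks_def)
    then show keys: "Poly_Mapping.keys (?h u) \<subseteq> ?V" "Poly_Mapping.keys (?h v) \<subseteq> ?V"
      using keys_homogenize_monomial[of ?y n] s by blast+
    have "restrict_to ?N (Poly_Mapping.map int (?h u) - Poly_Mapping.map int (?h v)) =
        Poly_Mapping.map int u - Poly_Mapping.map int v"
      using lookup_outside[OF u(1)] lookup_outside[OF v(1)]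
      by (intro poly_mapping_eqI)
        (auto simp: lookup_minus homogenize_monomial_def lookup_add lookup_single when_def nonsinks_def)
    moreover have "(\<Sum>x\<in>?V. Poly_Mapping.lookup (Poly_Mapping.map int (?h u) - Poly_Mapping.map int (?h v)) x) = 0"
      using monomial_degree_homogenize_monomial[OF fin s V(1) u(2)]
        monomial_degree_homogenize_monomial[OF fin s V(2) v(2)]
      by (simp add: lookup_minus sum_subtractf flip: of_nat_sum)
    ultimately show "Poly_Mapping.map int (?h u) - Poly_Mapping.map int (?h v) \<in> laplacian_lattice G"
      using uv keys keys_diff[of "Poly_Mapping.map int (?h u)" "Poly_Mapping.map int (?h v)"]
      by (auto simp: mem_laplacian_lattice_iff[OF fin s abs])
  qed

  have hom_mem: "homogenize ?y f \<in> ?J" if f: "f \<in> toppling_ideal G" for f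
  proof -
    let ?h = "homogenize_monomial ?y (total_degree f)"
    let ?c = "Poly_Mapping.lookup f"
    define E where "E u v \<longleftrightarrow> Poly_Mapping.keys v \<subseteq> ?N \<and> Poly_Mapping.map int u - Poly_Mapping.map int v \<in> ?L"
      for u v
    define r where "r u = arg_min monomial_degree (E u)" for u
    have L_diff: "a - b \<in> ?L" if "a \<in> ?L" "b \<in> ?L" for a b
    proof -
      from that obtain D D' where "Poly_Mapping.keys D \<subseteq> ?N" "Poly_Mapping.keys D' \<subseteq> ?N"
        "a = reduced_laplacian G D" "b = reduced_laplacian G D'" by auto
      then show ?thesis using keys_diff[of D D']
        by (intro image_eqI[of _ _ "D - D'"]) (auto simp: reduced_laplacian_def frag_extend_diff)
    qed
    have L_0: "0 \<in> ?L" by (rule image_eqI[of _ _ 0]) (auto simp: reduced_laplacian_def)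
    have E_refl: "E u u" if "Poly_Mapping.keys u \<subseteq> ?N" for u
      using that L_0 by (simp add: E_def)
    have r: "E u (r u)" "monomial_degree (r u) \<le> monomial_degree u" if "Poly_Mapping.keys u \<subseteq> ?N" for u
      using arg_min_nat_lemma[of "E u" u monomial_degree] E_refl[OF that] by (auto simp: r_def)
    have r_eq: "r u = r v" if "Poly_Mapping.map int u - Poly_Mapping.map int v \<in> ?L" for u v
    proof -
      have "E u w \<longleftrightarrow> E v w" for w
      proof -
        let ?i = "Poly_Mapping.map int"
        have "?i v - ?i w = (?i u - ?i w) - (?i u - ?i v)" 
          and "?i u - ?i w = (?i v - ?i w) - (0 - (?i u - ?i v))" by simp_all
        then show ?thesis unfolding E_def using L_diff L_0 that by metis
      qed
      then have "E u = E v" by blast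
      then show ?thesis by (simp add: r_def)
    qed
    have deg: "Poly_Mapping.keys m \<subseteq> ?N" "monomial_degree m \<le> total_degree f" if "m \<in> Poly_Mapping.keys f" for m
    proof -
      have "f \<in> carrier (poly_ring ?N)" using f toppling_ideal_carrier by blast
      then show "Poly_Mapping.keys m \<subseteq> ?N" using that by (simp add: carrier_poly_ring_iff)
      show "monomial_degree m \<le> total_degree f" using that by (simp add: total_degree_def)
    qed
    (* r is constant on classes, so the coefficients of f cancel class by class *)
    have "push_monomials (\<lambda>m. ?h (r m)) f = 0"
      using r_eq by (intro push_monomials_toppling_ideal[OF f]) metis
    then have "homogenize ?y f = push_monomials ?h f - push_monomials (\<lambda>m. ?h (r m)) f"
      by (simp add: homogenize_def push_monomials_def homogenize_monomial_def)
    also have "\<dots> = (\<Sum>m\<in>Poly_Mapping.keys f. Poly_Mapping.single 0 (?c m) * (mon (?h m) - mon (?h (r m))))"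
      by (simp add: push_monomials_def sum_subtractf right_diff_distrib mult_single)
    also have "\<dots> \<in> ?J"
    proof (intro ideal_sum[OF J] ideal_mult[OF J] single_in_poly_ring hom_in_J)
      fix m assume "m \<in> Poly_Mapping.keys f"
      with deg r(2)[of m] r(1)[of m] show "Poly_Mapping.keys m \<subseteq> ?N" "monomial_degree m \<le> total_degree f"
        "Poly_Mapping.keys (r m) \<subseteq> ?N" "monomial_degree (r m) \<le> total_degree f"
        "Poly_Mapping.map int m - Poly_Mapping.map int (r m) \<in> ?L"
        by (fastforce simp: E_def)+
    qed simp
    finally show ?thesis .
  qed
  then have hom_J: "homogenize ?y ` toppling_ideal G \<subseteq> ?J" by blast
  then show "homogenized_toppling_ideal G \<subseteq> ?J"
    unfolding homogenized_toppling_ideal_def by (rule R.genideal_minimal[OF J])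

  have carr: "homogenize ?y ` toppling_ideal G \<subseteq> carrier (poly_ring ?V)"
    using hom_J ideal_carrier[OF J] by blast
  let ?K = "Idl\<^bsub>poly_ring ?V\<^esub> (homogenize ?y ` toppling_ideal G)"
  have K: "ideal ?K (poly_ring ?V)" by (rule R.genideal_ideal[OF carr])
  have "mon u - mon v \<in> ?K"
    if u: "Poly_Mapping.keys u \<subseteq> ?V" and v: "Poly_Mapping.keys v \<subseteq> ?V"
      and uv: "Poly_Mapping.map int u - Poly_Mapping.map int v \<in> laplacian_lattice G" for u v
  proof (cases "u = v")
    case True
    then show ?thesis using ideal_zero[OF K] by simp
  next
    case False
    define u' v' where "u' = restrict_to ?N u" and "v' = restrict_to ?N v"
    have N: "Poly_Mapping.keys u' \<subseteq> ?N" "Poly_Mapping.keys v' \<subseteq> ?N"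
      by (auto simp: u'_def v'_def keys_restrict_to)
    define n where "n = monomial_degree u"
    have res: "restrict_to ?N (Poly_Mapping.map int u - Poly_Mapping.map int v) \<in> ?L"
      using uv by (auto simp: mem_laplacian_lattice_iff[OF fin s abs])
    have nv: "n = monomial_degree v"
      unfolding n_def by (rule laplacian_lattice_monomial_degree_eq[OF fin u v uv])
    have split: "w = restrict_to ?N w + Poly_Mapping.single ?y (Poly_Mapping.lookup w ?y)"
      "monomial_degree w = monomial_degree (restrict_to ?N w) + Poly_Mapping.lookup w ?y"
      if w: "Poly_Mapping.keys w \<subseteq> ?V" for w :: "'a \<Rightarrow>\<^sub>0 nat"
    proof -
      show "w = restrict_to ?N w + Poly_Mapping.single ?y (Poly_Mapping.lookup w ?y)"
        using lookup_outside[OF w]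
        by (intro poly_mapping_eqI) (auto simp: lookup_add lookup_single when_def nonsinks_def)
      have "monomial_degree (restrict_to ?N w) = (\<Sum>v\<in>?N. Poly_Mapping.lookup (restrict_to ?N w) v)"
        using fin by (intro monomial_degree_eq) (auto simp: nonsinks_def keys_restrict_to)
      then show "monomial_degree w = monomial_degree (restrict_to ?N w) + Poly_Mapping.lookup w ?y"
        using sum.remove[OF fin s, of "Poly_Mapping.lookup w"]
        by (simp add: monomial_degree_eq[OF fin w] nonsinks_def)
    qed
    have ne: "u' \<noteq> v'"
      using split[OF u] split[OF v] nv False by (auto simp: n_def u'_def v'_def)
    define f :: "'a mpoly" where "f = mon u' - mon v'"
    have lookup_f: "Poly_Mapping.lookup f u' = 1" "Poly_Mapping.lookup f v' = -1"
      using ne by (auto simp: f_def lookup_minus lookup_single when_def)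
    have keys_f: "Poly_Mapping.keys f = {u', v'}"
      using ne by (auto simp: f_def in_keys_iff lookup_minus lookup_single when_def split: if_splits)
    define d where "d = total_degree f"
    have d: "d = max (monomial_degree u') (monomial_degree v')"
      by (simp add: d_def total_degree_def keys_f)
    have "Poly_Mapping.map int u' - Poly_Mapping.map int v' \<in> ?L"
    proof -
      have "Poly_Mapping.map int u' - Poly_Mapping.map int v'
          = restrict_to ?N (Poly_Mapping.map int u - Poly_Mapping.map int v)"
        by (intro poly_mapping_eqI) (auto simp: u'_def v'_def lookup_minus)
      then show ?thesis using res by simp
    qed
    then have "f \<in> toppling_ideal G"
      unfolding toppling_ideal_eq_span f_def
      using N by (intro mpoly.span_base lattice_binomialsI)
    then have fK: "homogenize ?y f \<in> ?K"
      using R.genideal_self[OF carr] by blast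
    have hom_f: "homogenize ?y f = mon (homogenize_monomial ?y d u') - mon (homogenize_monomial ?y d v')"
      using ne by (simp add: homogenize_def keys_f lookup_f homogenize_monomial_def d_def single_uminus)
    (* dehomogenizing and homogenizing again to degree d removes exactly n - d copies of the sink variable *)
    have factor: "w = Poly_Mapping.single ?y (n - d) + homogenize_monomial ?y d (restrict_to ?N w)"
      if w: "Poly_Mapping.keys w \<subseteq> ?V" "monomial_degree w = n"
        "monomial_degree (restrict_to ?N w) \<le> d" "d \<le> n" for w
    proof -
      have "n - d + (d - monomial_degree (restrict_to ?N w)) = Poly_Mapping.lookup w ?y"
        using split(2)[OF w(1)] w(2-4) by simp
      then have "Poly_Mapping.single ?y (n - d) + Poly_Mapping.single ?y (d - monomial_degree (restrict_to ?N w))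
          = Poly_Mapping.single ?y (Poly_Mapping.lookup w ?y)"
        by (metis single_add)
      with split(1)[OF w(1)] show ?thesis
        unfolding homogenize_monomial_def by (metis add.left_commute)
    qed
    have "d \<le> n"
      using split(2)[OF u] split(2)[OF v] nv by (simp add: d n_def u'_def v'_def)
    have "monomial_degree u = n" "monomial_degree v = n"
      using nv by (simp_all add: n_def)
    moreover have "monomial_degree (restrict_to ?N u) \<le> d" "monomial_degree (restrict_to ?N v) \<le> d"
      by (simp_all add: d u'_def v'_def)
    ultimately have uv_eq: "u = Poly_Mapping.single ?y (n - d) + homogenize_monomial ?y d u'"
      "v = Poly_Mapping.single ?y (n - d) + homogenize_monomial ?y d v'"
      unfolding u'_def v'_def using factor[OF u _ _ \<open>d \<le> n\<close>] factor[OF v _ _ \<open>d \<le> n\<close>] by blast+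
    have "Poly_Mapping.keys (Poly_Mapping.single ?y (n - d)) \<subseteq> ?V" using s by simp
    from cong_add[OF K this fK[unfolded hom_f]] show ?thesis
      using uv_eq by metis
  qed
  then have "lattice_binomials ?V (laplacian_lattice G) \<subseteq> ?K"
    by (auto simp: lattice_binomials_def)
  then show "?J \<subseteq> homogenized_toppling_ideal G"
    unfolding homogenized_toppling_ideal_def by (rule R.genideal_minimal[OF K])
qed

section \<open>Generators for wirings\<close>

text \<open>The Laplacian of a wiring restricts to the Laplacians of the two pieces, except at the sink
  of \<open>G1\<close>, where it is the wiring divisor minus the vector \<open>e\<close> of weights into \<open>G2\<close>. Choosing an
  effective \<open>d\<close> in the linear system of the wiring divisor changes this generator only by an element of
  the lattice of \<open>G1\<close>. Moreover \<open>d\<close> inherits the coordinate sum of \<open>e\<close>, so it is nonzero as well.\<close>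

lemma wiring_lattice:
  assumes w: "wiring G1 G2 G"
  obtains d e where "Poly_Mapping.keys d \<subseteq> verts G1" "Poly_Mapping.keys e \<subseteq> verts G2" "d \<noteq> 0" "e \<noteq> 0"
    "laplacian_lattice G = {l1 + l2 + frag_cmul k (Poly_Mapping.map int d - Poly_Mapping.map int e) |
       l1 l2 k. l1 \<in> laplacian_lattice G1 \<and> l2 \<in> laplacian_lattice G2}"
proof -
  let ?V = "verts G" and ?V1 = "verts G1" and ?V2 = "verts G2" and ?s = "sink G1"
  have fin: "finite ?V" "finite ?V1" "finite ?V2" and s: "?s \<in> ?V1"
    and abs: "absolute_sink G1" and disj: "?V1 \<inter> ?V2 = {}" and V: "?V = ?V1 \<union> ?V2"
    and wt1: "\<And>u v. u \<in> nonsinks G1 \<Longrightarrow> v \<in> ?V1 \<Longrightarrow> wt G u v = wt G1 u v"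
    and wt2: "\<And>u v. u \<in> ?V2 \<Longrightarrow> v \<in> ?V2 \<Longrightarrow> wt G u v = wt G2 u v"
    and wired: "\<exists>v\<in>?V2. wt G ?s v > 0"
    and linsys: "complete_linear_system G1 (wiring_divisor G1 G) \<noteq> {}"
    using w unfolding wiring_def sandpile_graph_def by auto
  have "\<forall>(u, v) \<in> (nonsinks G1 \<times> ?V2) \<union> (?V2 \<times> ?V1). wt G u v = 0"
    using w by (simp add: wiring_def)
  then have wt12: "\<And>u v. u \<in> nonsinks G1 \<Longrightarrow> v \<in> ?V2 \<Longrightarrow> wt G u v = 0"
    and wt21: "\<And>u v. u \<in> ?V2 \<Longrightarrow> v \<in> ?V1 \<Longrightarrow> wt G u v = 0"
    by blast+
  have N1: "nonsinks G1 \<subseteq> ?V1" by (auto simp: nonsinks_def)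
  have outdeg: "outdeg G v = (\<Sum>u\<in>?V1. wt G v u) + (\<Sum>u\<in>?V2. wt G v u)" for v
    unfolding outdeg_def V using fin disj by (simp add: sum.union_disjoint)
  have lap1: "laplacian G D = laplacian G1 D" if "Poly_Mapping.keys D \<subseteq> nonsinks G1" for D
    using that
  proof (induction rule: frag_induction)
    case (one x)
    then have "outdeg G x = outdeg G1 x"
      using wt1 wt12 by (simp add: outdeg outdeg_def[of G1])
    with one show ?case using fin wt1 wt12 N1 disj
      by (intro poly_mapping_eqI) (auto simp: lookup_laplacian_frag_of V)
  qed (simp_all add: laplacian_0 laplacian_diff)
  have lap2: "laplacian G D = laplacian G2 D" if "Poly_Mapping.keys D \<subseteq> ?V2" for D
    using that
  proof (induction rule: frag_induction)
    case (one x)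
    then have "outdeg G x = outdeg G2 x"
      using wt2 wt21 by (simp add: outdeg outdeg_def[of G2])
    with one show ?case using fin wt2 wt21 disj
      by (intro poly_mapping_eqI) (auto simp: lookup_laplacian_frag_of V)
  qed (simp_all add: laplacian_0 laplacian_diff)
  have lap1': "laplacian G1 D = laplacian G (restrict_to (nonsinks G1) D)" if "Poly_Mapping.keys D \<subseteq> ?V1" for D
    using laplacian_restrict_nonsinks[OF fin(2) s abs that] lap1[of "restrict_to (nonsinks G1) D"]
    by (simp add: keys_restrict_to)

  define e where "e = (\<Sum>v\<in>?V2. Poly_Mapping.single v (wt G ?s v))"
  have lookup_e: "Poly_Mapping.lookup e x = (if x \<in> ?V2 then wt G ?s x else 0)" for x
    using fin by (simp add: e_def lookup_sum lookup_single when_def)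
  have e_keys: "Poly_Mapping.keys e \<subseteq> ?V2" by (auto simp: in_keys_iff lookup_e split: if_splits)
  have e_nz: "e \<noteq> 0" using wired lookup_e by (metis lookup_zero less_numeral_extra(3))
  have s_split: "laplacian G (frag_of ?s) = wiring_divisor G1 G - Poly_Mapping.map int e"
    unfolding wiring_divisor_def using fin s disj
    by (intro poly_mapping_eqI)
      (auto simp: lookup_minus lookup_vertex_sum lookup_e lookup_laplacian_frag_of V)
  from linsys obtain W B where W: "Poly_Mapping.keys W \<subseteq> ?V1" "\<And>v. 0 \<le> Poly_Mapping.lookup W v"
    and B: "Poly_Mapping.keys B \<subseteq> ?V1" "wiring_divisor G1 G - W = laplacian G1 B"
    unfolding complete_linear_system_def linearly_equivalent_def by auto
  define d where "d = Poly_Mapping.map nat W"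
  have map_d: "Poly_Mapping.map int d = W"
  proof (rule poly_mapping_eqI)
    fix v
    show "Poly_Mapping.lookup (Poly_Mapping.map int d) v = Poly_Mapping.lookup W v"
      using W(2)[of v] by (simp add: d_def Poly_Mapping.map.rep_eq when_def)
  qed
  have d_keys: "Poly_Mapping.keys d \<subseteq> ?V1" using W(1) unfolding map_d[symmetric] by simp
  define g where "g = Poly_Mapping.map int d - Poly_Mapping.map int e"
  define B' where "B' = restrict_to (nonsinks G1) B"
  have B'_keys: "Poly_Mapping.keys B' \<subseteq> nonsinks G1" by (simp add: B'_def keys_restrict_to)
  (* B is the firing script that turns the wiring divisor into W; its part away from the sink of G1
     is also a firing script on G, where the sink of G1 may act differently. *)
  have s_eq: "laplacian G (frag_of ?s) = laplacian G1 B + g"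
    unfolding B(2)[symmetric] g_def s_split map_d by simp
  have g_eq: "g = laplacian G (frag_of ?s - B')"
    using s_eq lap1'[OF B(1)] by (simp add: laplacian_diff B'_def)

  have "d \<noteq> 0"
  proof
    assume "d = 0"
    have "Poly_Mapping.keys (frag_of ?s - B') \<subseteq> ?V"
      using keys_diff[of "frag_of ?s" B'] B'_keys N1 s V by auto
    from sum_laplacian[OF fin(1) this] have "(\<Sum>v\<in>?V. Poly_Mapping.lookup g v) = 0"
      by (simp add: g_eq)
    with \<open>d = 0\<close> have "(\<Sum>v\<in>?V. Poly_Mapping.lookup e v) = 0"
      by (simp add: g_def lookup_minus sum_negf flip: of_nat_sum)
    then have "e = 0" using fin lookup_outside[OF e_keys] V by (intro poly_mapping_eqI) auto
    with e_nz show False ..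
  qed
  moreover have "laplacian_lattice G = {l1 + l2 + frag_cmul k g | l1 l2 k.
      l1 \<in> laplacian_lattice G1 \<and> l2 \<in> laplacian_lattice G2}" (is "_ = ?R")
  proof (intro subset_antisym subsetI)
    fix l assume "l \<in> laplacian_lattice G"
    then obtain D where D: "Poly_Mapping.keys D \<subseteq> ?V" "l = laplacian G D"
      by (auto simp: laplacian_lattice_def)
    define D1 D2 c where "D1 = restrict_to (nonsinks G1) D" and "D2 = restrict_to ?V2 D"
      and "c = Poly_Mapping.lookup D ?s"
    have keysD: "Poly_Mapping.keys D1 \<subseteq> nonsinks G1" "Poly_Mapping.keys D2 \<subseteq> ?V2"
      by (auto simp: D1_def D2_def keys_restrict_to)
    have "D = D1 + D2 + frag_cmul c (frag_of ?s)"
      using lookup_outside[OF D(1)] s disj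
      by (intro poly_mapping_eqI) (auto simp: D1_def D2_def c_def lookup_add nonsinks_def V)
    then have "l = laplacian G1 D1 + laplacian G2 D2 + frag_cmul c (laplacian G1 B + g)"
      using lap1[OF keysD(1)] lap2[OF keysD(2)] s_eq by (simp add: D(2) laplacian_add laplacian_cmul)
    then have "l = laplacian G1 (D1 + frag_cmul c B) + laplacian G2 D2 + frag_cmul c g"
      by (simp add: laplacian_add laplacian_cmul frag_cmul_distrib2 ac_simps)
    moreover have "Poly_Mapping.keys (D1 + frag_cmul c B) \<subseteq> ?V1"
      using Poly_Mapping.keys_add[of D1 "frag_cmul c B"] keys_cmul[of c B] keysD N1 B by blast
    ultimately show "l \<in> ?R" using keysD laplacian_latticeI by blast
  next
    fix l assume "l \<in> ?R"
    then obtain D1 D2 k where D: "Poly_Mapping.keys D1 \<subseteq> ?V1" "Poly_Mapping.keys D2 \<subseteq> ?V2"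
      and l: "l = laplacian G1 D1 + laplacian G2 D2 + frag_cmul k g"
      by (auto simp: laplacian_lattice_def)
    let ?D = "restrict_to (nonsinks G1) D1 + D2 + frag_cmul k (frag_of ?s - B')"
    have "l = laplacian G ?D"
      using lap1'[OF D(1)] lap2[OF D(2)] by (simp add: l g_eq laplacian_add laplacian_cmul)
    moreover have "Poly_Mapping.keys ?D \<subseteq> ?V"
    proof -
      have "Poly_Mapping.lookup ?D x = 0" if "x \<notin> ?V" for x
        using that s N1 lookup_outside[OF D(2)] lookup_outside[OF B'_keys]
        by (auto simp: lookup_add lookup_minus V)
      then show ?thesis by (auto simp: in_keys_iff)
    qed
    ultimately show "l \<in> laplacian_lattice G" using laplacian_latticeI by blast
  qed
  ultimately show ?thesis using that d_keys e_keys e_nz unfolding g_def by blast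
qed

lemma laplacian_lattice_uminus: "l \<in> laplacian_lattice G \<Longrightarrow> - l \<in> laplacian_lattice G"
proof -
  assume "l \<in> laplacian_lattice G"
  then obtain D where D: "Poly_Mapping.keys D \<subseteq> verts G" "l = laplacian G D"
    by (auto simp: laplacian_lattice_def)
  have "laplacian G (- D) = - l" by (simp add: D laplacian_def frag_extend_minus)
  then show ?thesis using laplacian_latticeI[of "- D" G] D by simp
qed

lemma lattice_binomials_mono:
  "A \<subseteq> B \<Longrightarrow> L \<subseteq> M \<Longrightarrow> lattice_binomials A L \<subseteq> lattice_binomials B M"
  unfolding lattice_binomials_def by blast

lemma keys_mon_diff: "u \<noteq> v \<Longrightarrow> Poly_Mapping.keys (mon u - mon v) = {u, v}"
  by (auto simp: in_keys_iff lookup_minus lookup_single when_def split: if_splits)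

lemma laplacian_lattice_keys:
  assumes "finite (verts G)" "l \<in> laplacian_lattice G"
  shows "Poly_Mapping.keys l \<subseteq> verts G"
proof -
  from assms(2) obtain D where "Poly_Mapping.keys D \<subseteq> verts G" "l = laplacian G D"
    by (auto simp: laplacian_lattice_def)
  then show ?thesis using keys_laplacian[OF assms(1)] by simp
qed

lemma completely_wired_absolute_sink:
  assumes "completely_wired G"
  shows "finite (verts G)" "sink G \<in> verts G" "absolute_sink G"
proof -
  have "finite (verts G) \<and> sink G \<in> verts G \<and> absolute_sink G"
    using assms
  proof cases
    case single_vertex
    then show ?thesis by (auto simp: absolute_sink_def outdeg_def edges_def)
  next
    case (wired G1 G2)
    then show ?thesis by (auto simp: wiring_def sandpile_graph_def)
  qed
  then show "finite (verts G)" "sink G \<in> verts G" "absolute_sink G" by auto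
qed

text \<open>That \<open>0\<close> is excluded from \<open>F\<close> makes the count exact in the inductive step: a binomial common to
  both pieces could only involve the monomial \<open>1\<close> and would vanish, and the new binomial \<open>x\<^sup>d - x\<^sup>e\<close>
  involves variables of both pieces.\<close>

lemma completely_wired_generators:
  assumes "completely_wired G"
  shows "\<exists>F\<subseteq>lattice_binomials (verts G) (laplacian_lattice G).
    finite F \<and> 0 \<notin> F \<and> card F = card (verts G) - 1 \<and>
    lattice_binomials (verts G) (laplacian_lattice G) \<subseteq> Idl\<^bsub>poly_ring (verts G)\<^esub> F"
  using assms
proof induction
  case (single_vertex G)
  then have "completely_wired G" by (rule completely_wired.single_vertex)
  note G = completely_wired_absolute_sink[OF this]
  have "l = 0" if l: "l \<in> laplacian_lattice G" for l
  proof -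
    from l obtain D where D: "Poly_Mapping.keys D \<subseteq> verts G" "l = laplacian G D"
      by (auto simp: laplacian_lattice_def)
    have "restrict_to (nonsinks G) D = 0"
      using single_vertex by (intro poly_mapping_eqI) (simp add: nonsinks_def)
    then show ?thesis using laplacian_restrict_nonsinks[OF G D(1)] by (simp add: D laplacian_0)
  qed
  then have "f = 0" if "f \<in> lattice_binomials (verts G) (laplacian_lattice G)" for f
    using that unfolding lattice_binomials_def
    by clarsimp (metis eq_iff_diff_eq_0 lookup_map_int of_nat_eq_iff poly_mapping_eqI)
  moreover have "ideal (Idl\<^bsub>poly_ring (verts G)\<^esub> {}) (poly_ring (verts G))"
    by (intro ring.genideal_ideal[OF ring_poly_ring]) simp
  ultimately have "lattice_binomials (verts G) (laplacian_lattice G) \<subseteq> Idl\<^bsub>poly_ring (verts G)\<^esub> {}"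
    using ideal_zero by blast
  then show ?case using single_vertex by (intro exI[of _ "{}"]) simp
next
  case (wired G1 G2 G)
  let ?V = "verts G" and ?V1 = "verts G1" and ?V2 = "verts G2"
  let ?L = "laplacian_lattice G" and ?L1 = "laplacian_lattice G1" and ?L2 = "laplacian_lattice G2"
  note G1 = completely_wired_absolute_sink[OF \<open>completely_wired G1\<close>]
  note G2 = completely_wired_absolute_sink[OF \<open>completely_wired G2\<close>]
  have V: "?V = ?V1 \<union> ?V2" and disj: "?V1 \<inter> ?V2 = {}"
    using \<open>wiring G1 G2 G\<close> by (auto simp: wiring_def)
  obtain d e where d: "Poly_Mapping.keys d \<subseteq> ?V1" "d \<noteq> 0" and e: "Poly_Mapping.keys e \<subseteq> ?V2" "e \<noteq> 0"
    and L: "?L = {l1 + l2 + frag_cmul k (Poly_Mapping.map int d - Poly_Mapping.map int e) |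
       l1 l2 k. l1 \<in> ?L1 \<and> l2 \<in> ?L2}"
    by (rule wiring_lattice[OF \<open>wiring G1 G2 G\<close>])
  have zero: "0 \<in> laplacian_lattice H" for H :: "'a wgraph"
    using laplacian_latticeI[of 0 H] by (simp add: laplacian_0)
  have L1_sub: "?L1 \<subseteq> ?L" and L2_sub: "?L2 \<subseteq> ?L"
    and de_L: "Poly_Mapping.map int d - Poly_Mapping.map int e \<in> ?L"
  proof -
    show "?L1 \<subseteq> ?L" using zero by (force simp: L intro: exI[of _ "0::int"])
    show "?L2 \<subseteq> ?L" using zero by (force simp: L intro: exI[of _ "0::int"])
    have "Poly_Mapping.map int d - Poly_Mapping.map int e
        = 0 + 0 + frag_cmul 1 (Poly_Mapping.map int d - Poly_Mapping.map int e)" by simp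
    then show "Poly_Mapping.map int d - Poly_Mapping.map int e \<in> ?L" unfolding L using zero by blast
  qed
  obtain F1 where F1: "F1 \<subseteq> lattice_binomials ?V1 ?L1" "finite F1" "0 \<notin> F1" "card F1 = card ?V1 - 1"
    "lattice_binomials ?V1 ?L1 \<subseteq> Idl\<^bsub>poly_ring ?V1\<^esub> F1"
    using wired.IH(1) by blast
  obtain F2 where F2: "F2 \<subseteq> lattice_binomials ?V2 ?L2" "finite F2" "0 \<notin> F2" "card F2 = card ?V2 - 1"
    "lattice_binomials ?V2 ?L2 \<subseteq> Idl\<^bsub>poly_ring ?V2\<^esub> F2"
    using wired.IH(2) by blast
  define g where "g = mon d - mon e"
  define F where "F = insert g (F1 \<union> F2)"
  have "d \<noteq> e"
  proof
    assume "d = e"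
    then have "Poly_Mapping.keys d = {}" using d e disj by blast
    then show False using d by simp
  qed
  then have keys_g: "Poly_Mapping.keys g = {d, e}" and g_nz: "g \<noteq> 0"
    using keys_mon_diff[of d e] by (auto simp: g_def)
  have "F1 \<inter> F2 = {}"
  proof (rule ccontr)
    assume "F1 \<inter> F2 \<noteq> {}"
    then obtain f where f: "f \<in> F1" "f \<in> F2" by blast
    then have "f \<in> carrier (poly_ring ?V1)" "f \<in> carrier (poly_ring ?V2)"
      using F1 F2 lattice_binomials_carrier by blast+
    then have "Poly_Mapping.keys m = {}" if "m \<in> Poly_Mapping.keys f" for m
      using that disj by (fastforce simp: carrier_poly_ring_iff)
    then have k: "m = 0" if "m \<in> Poly_Mapping.keys f" for m using that by simp
    obtain u v where uv: "f = mon u - mon v" using f F1 by (auto simp: lattice_binomials_def)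
    have "u \<noteq> v" using f F1(3) uv by auto
    then show False using k keys_mon_diff[of u v] uv by auto
  qed
  moreover have "g \<notin> F1" "g \<notin> F2"
  proof -
    have "Poly_Mapping.keys d \<noteq> {}" "Poly_Mapping.keys e \<noteq> {}" using d e by simp_all
    then have "\<not> Poly_Mapping.keys d \<subseteq> ?V2" "\<not> Poly_Mapping.keys e \<subseteq> ?V1" using d e disj by blast+
    then have "g \<notin> carrier (poly_ring ?V1)" "g \<notin> carrier (poly_ring ?V2)"
      by (auto simp: carrier_poly_ring_iff keys_g)
    then show "g \<notin> F1" "g \<notin> F2" using F1 F2 lattice_binomials_carrier by blast+
  qed
  ultimately have "card F = Suc ((card ?V1 - 1) + (card ?V2 - 1))"
    using F1 F2 by (simp add: F_def card_Un_disjoint)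
  also have "\<dots> = card ?V - 1"
  proof -
    have "card ?V1 > 0" "card ?V2 > 0" using G1 G2 by (auto simp: card_gt_0_iff)
    moreover have "card ?V = card ?V1 + card ?V2" using V disj G1 G2 by (simp add: card_Un_disjoint)
    ultimately show ?thesis by simp
  qed
  finally have card: "card F = card ?V - 1" .

  have F_sub: "F \<subseteq> lattice_binomials ?V ?L"
  proof -
    have "F1 \<subseteq> lattice_binomials ?V ?L" "F2 \<subseteq> lattice_binomials ?V ?L"
      using F1 F2 lattice_binomials_mono[OF _ L1_sub, of ?V1 ?V] lattice_binomials_mono[OF _ L2_sub, of ?V2 ?V] V
      by blast+
    moreover have "g \<in> lattice_binomials ?V ?L"
      unfolding g_def using d e V de_L by (intro lattice_binomialsI) auto
    ultimately show ?thesis by (simp add: F_def)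
  qed
  let ?J = "Idl\<^bsub>poly_ring ?V\<^esub> F"
  have F_carr: "F \<subseteq> carrier (poly_ring ?V)" using F_sub lattice_binomials_carrier by blast
  have J: "ideal ?J (poly_ring ?V)" and FJ: "F \<subseteq> ?J"
    using F_carr by (simp_all add: ring.genideal_ideal[OF ring_poly_ring] ring.genideal_self[OF ring_poly_ring])
  have J1: "lattice_binomials ?V1 ?L1 \<subseteq> ?J"
    using F1(5) genideal_mono_carrier[OF J, of ?V1 F1] FJ F1(1) lattice_binomials_carrier V
    unfolding F_def by blast
  have J2: "lattice_binomials ?V2 ?L2 \<subseteq> ?J"
    using F2(5) genideal_mono_carrier[OF J, of ?V2 F2] FJ F2(1) lattice_binomials_carrier V
    unfolding F_def by blast
  have gJ: "mon d - mon e \<in> ?J" using FJ by (auto simp: F_def g_def)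
  note glue = binomial_glue[OF J[unfolded V] disj J1[unfolded V] J2[unfolded V] d(1) e(1) gJ[unfolded V],
      folded V]
  have "mon u - mon v \<in> ?J"
    if u: "Poly_Mapping.keys u \<subseteq> ?V" and v: "Poly_Mapping.keys v \<subseteq> ?V"
      and uv: "Poly_Mapping.map int u - Poly_Mapping.map int v \<in> ?L" for u v
  proof -
    from uv obtain l1 l2 k where l: "l1 \<in> ?L1" "l2 \<in> ?L2"
      and eq: "Poly_Mapping.map int u - Poly_Mapping.map int v
        = l1 + l2 + frag_cmul k (Poly_Mapping.map int d - Poly_Mapping.map int e)"
      unfolding L by blast
    note l_keys = laplacian_lattice_keys[OF G1(1) l(1)] laplacian_lattice_keys[OF G2(1) l(2)]
    (* for negative k, exchange the roles of u and v *)
    show ?thesis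
    proof (cases "k \<ge> 0")
      case True
      then show ?thesis
        using glue[OF u v l(1) l_keys(1) l(2) l_keys(2), of "nat k"] eq by simp
    next
      case False
      have "Poly_Mapping.map int v - Poly_Mapping.map int u
        = - l1 + - l2 + frag_cmul (int (nat (- k))) (Poly_Mapping.map int d - Poly_Mapping.map int e)"
        using False arg_cong[OF eq, of uminus] by (simp add: algebra_simps)
      then have "mon v - mon u \<in> ?J"
        using glue[OF v u laplacian_lattice_uminus[OF l(1)] _ laplacian_lattice_uminus[OF l(2)], of "nat (- k)"]
          l_keys by simp
      then show ?thesis by (rule cong_sym[OF J])
    qed
  qed
  then have "lattice_binomials ?V ?L \<subseteq> ?J" by (auto simp: lattice_binomials_def)
  moreover have "finite F" "0 \<notin> F" using F1 F2 g_nz by (auto simp: F_def)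
  ultimately show ?case using F_sub card by blast
qed

theorem theorem8p13:
  fixes G :: "'v wgraph"
  assumes "completely_wired G"
  shows "\<exists>F. finite F \<and> card F = card (verts G) - 1 \<and>
           F \<subseteq> carrier (poly_ring (verts G)) \<and> (\<forall>f\<in>F. homogeneous f) \<and>
           homogenized_toppling_ideal G = Idl\<^bsub>poly_ring (verts G)\<^esub> F"
proof -
  let ?B = "lattice_binomials (verts G) (laplacian_lattice G)"
  note G = completely_wired_absolute_sink[OF assms]
  obtain F where F: "F \<subseteq> ?B" "finite F" "card F = card (verts G) - 1"
    "?B \<subseteq> Idl\<^bsub>poly_ring (verts G)\<^esub> F"
    using completely_wired_generators[OF assms] by blast
  have carr: "F \<subseteq> carrier (poly_ring (verts G))"
    using F(1) lattice_binomials_carrier by blast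
  have "homogeneous f" if "f \<in> F" for f
  proof -
    from that F(1) obtain u v where f: "f = mon u - mon v"
      and "Poly_Mapping.keys u \<subseteq> verts G" "Poly_Mapping.keys v \<subseteq> verts G"
        "Poly_Mapping.map int u - Poly_Mapping.map int v \<in> laplacian_lattice G"
      unfolding lattice_binomials_def by blast
    then have "monomial_degree u = monomial_degree v"
      by (intro laplacian_lattice_monomial_degree_eq[OF G(1)])
    moreover have "Poly_Mapping.keys f \<subseteq> {u, v}"
      using keys_diff[of "mon u" "mon v"] by (auto simp: f)
    ultimately show ?thesis unfolding homogeneous_def by blast
  qed
  moreover have "homogenized_toppling_ideal G = Idl\<^bsub>poly_ring (verts G)\<^esub> F"
    unfolding homogenized_toppling_ideal_eq[OF G]
  proof (rule subset_antisym)
    interpret cring "poly_ring (verts G)" by (rule cring_poly_ring)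
    show "Idl\<^bsub>poly_ring (verts G)\<^esub> ?B \<subseteq> Idl\<^bsub>poly_ring (verts G)\<^esub> F"
      by (rule genideal_minimal[OF genideal_ideal[OF carr] F(4)])
    have "?B \<subseteq> Idl\<^bsub>poly_ring (verts G)\<^esub> ?B"
      by (rule genideal_self[OF lattice_binomials_carrier])
    then show "Idl\<^bsub>poly_ring (verts G)\<^esub> F \<subseteq> Idl\<^bsub>poly_ring (verts G)\<^esub> ?B"
      using F(1) by (intro genideal_minimal[OF genideal_ideal[OF lattice_binomials_carrier]]) blast
  qed
  ultimately show ?thesis using F carr by blast
qed

end
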